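(* Let $\bar\lambda=\langle\lambda_i: i<\kappa\rangle$ be a sequence of infinite regular cardinals, $I^*$ an ideal on $\kappa$ and $\theta$ a cardinal such that at least one of the following holds: ($\alpha$) $\min_{i<\kappa}\lambda_i>\theta\ge \mathrm{wsat}(I^* )$; or ($\beta$) $\liminf_{I^*}(\bar\lambda)\ge\theta\ge\mathrm{wsat}(I^* )$ and $(\prod\bar\lambda,\le_{I^*})$ is $\theta^+$-directed. If $D$ is an ultrafilter on $\kappa$ with $D\cap I^*=\emptyset$ and $\lambda=\mathrm{tcf}(\prod\bar\lambda,<_D)$, then for some $B\in D$ the partial order $(\prod\bar\lambda\restriction B,<_{J_{<\lambda}[\bar\lambda]})$ has true cofinality $\lambda$ (so $B\in J_{\le\lambda}[\bar\lambda]\setminus J_{<\lambda}[\bar\lambda]$).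
   Context: $\kappa$ is an infinite cardinal; $I^*$ is a proper ideal on $\kappa$; $\prod\bar\lambda=\prod_{i<\kappa}\lambda_i$. For an ideal $J$ on $\kappa$ and ordinal-valued functions $f,g$ on $\kappa$: $f<_J g$ means $\{i<\kappa:\neg f(i)<g(i)\}\in J$; similarly $\le_J$. For $B\subseteq\kappa$, $(\prod\bar\lambda\restriction B,<_J)$ is $\prod_{i\in B}\lambda_i$ ordered modulo $J\cap\mathcal P(B)$. For a filter $D$, $<_D$ refers to the dual ideal. $J^+=\mathcal P(\kappa)\setminus J$. A (quasi-)partial order $P$ is $\lambda$-directed if every $A\subseteq P$ with $|A|<\lambda$ has an upper bound in $P$. $P$ has true cofinality $\lambda$ if there is a strictly increasing sequence $\langle p_\alpha:\alpha<\lambda\rangle$ in $P$ such that every $q\in P$ satisfies $q\le p_\alpha$ for some $\alpha$; $\mathrm{tcf}(P)$ is the least such $\lambda$. $\liminf_{I}(\bar\lambda)=\min\{\mu:\{i<\kappa:\lambda_i\le\mu\}\in I^+\}$. $\mathrm{wsat}(I)$ is the least cardinal $\theta$ such that $\kappa$ cannot be partitioned into $\theta$ pairwise disjoint sets each in $I^+$. $J_{<\lambda}[\bar\lambda]=\{B\subseteq\kappa:$ there is no ultrafilter $D$ on $\kappa$ with $D\cap I^*=\emptyset$, $B\in D$ and $\mathrm{tcf}(\prod\bar\lambda/D)\ge\lambda\}$ (a possibly improper ideal extending $I^*$), and $J_{\le\lambda}[\bar\lambda]=J_{<\lambda^+}[\bar\lambda]$. *)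

theory Defs
  imports Main "HOL-Library.FuncSet" "HOL-Library.Disjoint_Sets"
begin

unbundle cardinal_syntax

text \<open>
  Cardinals are the cardinal order relations of \<^theory>\<open>HOL.BNF_Cardinal_Arithmetic\<close>, compared
  by \<open>\<le>o\<close>, \<open><o\<close> and \<open>=o\<close>, so they are determined only up to order isomorphism. The cardinal
  \<open>\<kappa>\<close> is a relation on \<open>'k\<close> whose field \<open>K\<close> is the index set, and each \<open>\<lambda>\<^sub>i\<close> is a relation
  on one common type \<open>'a\<close>, whose field is the set of ordinals below \<open>\<lambda>\<^sub>i\<close>.
\<close>

subsection \<open>Least cardinals\<close>

text \<open>
  The candidates range over the cardinals of a single type \<open>'b\<close>. If \<open>P\<close> is invariant under
  isomorphism, no cardinal of another type can be smaller than such a least one, since every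
  cardinal below it has an isomorphic copy on \<open>'b\<close>.
\<close>

definition is_least_card :: "('b rel \<Rightarrow> bool) \<Rightarrow> 'b rel \<Rightarrow> bool" where
  "is_least_card P r \<longleftrightarrow>
     Card_order r \<and> P r \<and> (\<forall>r'. Card_order r' \<and> P r' \<longrightarrow> r \<le>o r')"

definition least_card :: "('b rel \<Rightarrow> bool) \<Rightarrow> 'b rel" where
  "least_card P = (SOME r. is_least_card P r)"

lemma is_least_card_least_card:
  assumes "Card_order r" "P r"
  shows "is_least_card P (least_card P)"
proof -
  have "\<exists>r\<in>{r. Card_order r \<and> P r}. \<forall>r'\<in>{r. Card_order r \<and> P r}. r \<le>o r'"
    using assms by (intro exists_minim_Card_order) auto
  then have "\<exists>r. is_least_card P r"
    by (auto simp: is_least_card_def)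
  then show ?thesis
    unfolding least_card_def by (rule someI_ex)
qed

subsection \<open>Ideals and ultrafilters on a set\<close>

definition ideal_on :: "'k set \<Rightarrow> 'k set set \<Rightarrow> bool" where
  "ideal_on K I \<longleftrightarrow>
     I \<subseteq> Pow K \<and> {} \<in> I \<and> (\<forall>A\<in>I. \<forall>B. B \<subseteq> A \<longrightarrow> B \<in> I) \<and> (\<forall>A\<in>I. \<forall>B\<in>I. A \<union> B \<in> I)"

definition proper_ideal_on :: "'k set \<Rightarrow> 'k set set \<Rightarrow> bool" where
  "proper_ideal_on K I \<longleftrightarrow> ideal_on K I \<and> K \<notin> I"

definition positive_sets :: "'k set \<Rightarrow> 'k set set \<Rightarrow> 'k set set" where
  "positive_sets K I = Pow K - I"

definition ultrafilter_on :: "'k set \<Rightarrow> 'k set set \<Rightarrow> bool" where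
  "ultrafilter_on K D \<longleftrightarrow>
     D \<subseteq> Pow K \<and> K \<in> D \<and> {} \<notin> D \<and>
     (\<forall>A\<in>D. \<forall>B. A \<subseteq> B \<and> B \<subseteq> K \<longrightarrow> B \<in> D) \<and> (\<forall>A\<in>D. \<forall>B\<in>D. A \<inter> B \<in> D) \<and>
     (\<forall>A. A \<subseteq> K \<longrightarrow> A \<in> D \<or> K - A \<in> D)"

definition dual_ideal :: "'k set \<Rightarrow> 'k set set \<Rightarrow> 'k set set" where
  "dual_ideal K D = {A. A \<subseteq> K \<and> K - A \<in> D}"

subsection \<open>Products modulo an ideal\<close>

definition card_prod :: "'k set \<Rightarrow> ('k \<Rightarrow> 'a rel) \<Rightarrow> ('k \<Rightarrow> 'a) set" where
  "card_prod B lam = (\<Pi>\<^sub>E i\<in>B. Field (lam i))"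

definition less_mod ::
    "'k set \<Rightarrow> ('k \<Rightarrow> 'a rel) \<Rightarrow> 'k set set \<Rightarrow> ('k \<Rightarrow> 'a) \<Rightarrow> ('k \<Rightarrow> 'a) \<Rightarrow> bool" where
  "less_mod B lam J f g \<longleftrightarrow> {i \<in> B. (f i, g i) \<notin> lam i - Id} \<in> J \<inter> Pow B"

definition le_mod ::
    "'k set \<Rightarrow> ('k \<Rightarrow> 'a rel) \<Rightarrow> 'k set set \<Rightarrow> ('k \<Rightarrow> 'a) \<Rightarrow> ('k \<Rightarrow> 'a) \<Rightarrow> bool" where
  "le_mod B lam J f g \<longleftrightarrow> {i \<in> B. (f i, g i) \<notin> lam i} \<in> J \<inter> Pow B"

subsection \<open>Directedness and true cofinality\<close>

definition directed_card :: "'p set \<Rightarrow> ('p \<Rightarrow> 'p \<Rightarrow> bool) \<Rightarrow> 'l rel \<Rightarrow> bool" where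
  "directed_card P le l \<longleftrightarrow> (\<forall>A. A \<subseteq> P \<and> |A| <o l \<longrightarrow> (\<exists>u\<in>P. \<forall>a\<in>A. le a u))"

text \<open>
  The strict and the weak order are separate arguments, because \<open>\<le>\<^sub>J\<close> is not the reflexive
  closure of \<open><\<^sub>J\<close>.
\<close>

definition has_tcf ::
    "'p set \<Rightarrow> ('p \<Rightarrow> 'p \<Rightarrow> bool) \<Rightarrow> ('p \<Rightarrow> 'p \<Rightarrow> bool) \<Rightarrow> 'l rel \<Rightarrow> bool" where
  "has_tcf P lt le l \<longleftrightarrow>
     Card_order l \<and>
     (\<exists>p. (\<forall>a\<in>Field l. p a \<in> P) \<and>
          (\<forall>a b. (a, b) \<in> l - Id \<longrightarrow> lt (p a) (p b)) \<and>
          (\<forall>q\<in>P. \<exists>a\<in>Field l. le q (p a)))"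

definition is_tcf ::
    "'p set \<Rightarrow> ('p \<Rightarrow> 'p \<Rightarrow> bool) \<Rightarrow> ('p \<Rightarrow> 'p \<Rightarrow> bool) \<Rightarrow> 'l rel \<Rightarrow> bool" where
  "is_tcf P lt le l \<longleftrightarrow> is_least_card (has_tcf P lt le) l"

abbreviation prod_has_tcf :: "'k set \<Rightarrow> ('k \<Rightarrow> 'a rel) \<Rightarrow> 'k set set \<Rightarrow> 'l rel \<Rightarrow> bool" where
  "prod_has_tcf B lam J \<equiv> has_tcf (card_prod B lam) (less_mod B lam J) (le_mod B lam J)"

abbreviation prod_is_tcf :: "'k set \<Rightarrow> ('k \<Rightarrow> 'a rel) \<Rightarrow> 'k set set \<Rightarrow> 'l rel \<Rightarrow> bool" where
  "prod_is_tcf B lam J \<equiv> is_tcf (card_prod B lam) (less_mod B lam J) (le_mod B lam J)"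

subsection \<open>The invariants liminf and wsat\<close>

definition liminf_card :: "'k set \<Rightarrow> 'k set set \<Rightarrow> ('k \<Rightarrow> 'a rel) \<Rightarrow> 'a rel" where
  "liminf_card K I lam = least_card (\<lambda>mu. {i \<in> K. lam i \<le>o mu} \<in> positive_sets K I)"

text \<open>
  Zero has to be excluded as a number of pieces: a nonempty set has no partition into zero
  pieces, so the least cardinal would always be zero. The type \<open>'k set rel\<close> is large enough,
  as there is no partition of \<open>\<kappa>\<close> into \<open>\<kappa>\<^sup>+\<close> nonempty pieces.
\<close>

definition wsat :: "'k set \<Rightarrow> 'k set set \<Rightarrow> 'k set rel" where
  "wsat K I =
     least_card (\<lambda>t. Field t \<noteq> {} \<and>
       \<not> (\<exists>Q. partition_on K Q \<and> Q \<subseteq> positive_sets K I \<and> |Q| =o t))"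

lemma is_least_card_liminf_card:
  assumes "proper_ideal_on K I" and "\<And>i. i \<in> K \<Longrightarrow> Card_order (lam i)"
  shows "is_least_card (\<lambda>mu. {i \<in> K. lam i \<le>o mu} \<in> positive_sets K I) (liminf_card K I lam)"
  unfolding liminf_card_def
proof (rule is_least_card_least_card)
  show "Card_order |UNIV :: 'b set|"
    by (rule card_of_Card_order)
  have "lam i \<le>o |UNIV :: 'b set|" if "i \<in> K" for i
    using card_of_Field_ordIso[OF assms(2)[OF that]] card_of_mono1[OF subset_UNIV]
    by (meson ordIso_ordLeq_trans ordIso_symmetric)
  then have "{i \<in> K. lam i \<le>o |UNIV :: 'b set|} = K"
    by blast
  then show "{i \<in> K. lam i \<le>o |UNIV :: 'b set|} \<in> positive_sets K I"
    using assms(1) by (simp add: proper_ideal_on_def positive_sets_def)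
qed

lemma is_least_card_wsat:
  "is_least_card (\<lambda>t. Field t \<noteq> {} \<and>
     \<not> (\<exists>Q. partition_on K Q \<and> Q \<subseteq> positive_sets K I \<and> |Q| =o t)) (wsat K I)"
  unfolding wsat_def
proof (rule is_least_card_least_card)
  let ?c = "cardSuc |K|"
  show "Card_order ?c"
    by (simp add: cardSuc_Card_order card_of_Card_order)
  have less: "|K| <o ?c"
    by (simp add: cardSuc_greater card_of_Card_order)
  have "\<not> |Q| =o ?c" if Q: "partition_on K Q" for Q
  proof
    assume "|Q| =o ?c"
    have ne: "q \<noteq> {}" if "q \<in> Q" for q
      using Q that by (auto simp: partition_on_def)
    have "inj_on (\<lambda>q. SOME x. x \<in> q) Q"
    proof (rule inj_onI)
      fix q r assume *: "q \<in> Q" "r \<in> Q" "(SOME x. x \<in> q) = (SOME x. x \<in> r)"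
      have "(SOME x. x \<in> q) \<in> q" "(SOME x. x \<in> r) \<in> r"
        using ne *(1,2) by (simp_all add: some_in_eq)
      then have "q \<inter> r \<noteq> {}"
        using *(3) by auto
      then show "q = r"
        using Q *(1,2) by (auto simp: partition_on_def disjoint_def)
    qed
    moreover have "(\<lambda>q. SOME x. x \<in> q) ` Q \<subseteq> K"
    proof
      fix y assume "y \<in> (\<lambda>q. SOME x. x \<in> q) ` Q"
      then obtain q where "q \<in> Q" "y = (SOME x. x \<in> q)" by blast
      then have "q \<in> Q" "y \<in> q"
        using ne by (simp_all add: some_in_eq)
      then show "y \<in> K"
        using Q by (auto simp: partition_on_def)
    qed
    ultimately have "|Q| \<le>o |K|"
      by (meson card_of_ordLeq)
    then have "?c \<le>o |K|"
      using \<open>|Q| =o ?c\<close> ordIso_ordLeq_trans ordIso_symmetric by blast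
    then show False
      using less not_ordLess_ordLeq by blast
  qed
  moreover have "Field ?c \<noteq> {}"
  proof
    assume "Field ?c = {}"
    then have "|Field ?c| \<le>o |K|"
      by (simp add: card_of_empty)
    then have "?c \<le>o |K|"
      using card_of_Field_ordIso[OF \<open>Card_order ?c\<close>] ordIso_ordLeq_trans ordIso_symmetric by blast
    then show False
      using less not_ordLess_ordLeq by blast
  qed
  ultimately show "Field ?c \<noteq> {} \<and>
      \<not> (\<exists>Q. partition_on K Q \<and> Q \<subseteq> positive_sets K I \<and> |Q| =o ?c)"
    by blast
qed

subsection \<open>The pcf ideals\<close>

text \<open>
  A strictly increasing sequence modulo an ultrafilter is injective, so the true cofinality of an
  ultraproduct is at most the size of the product and is represented on the type \<open>'k \<Rightarrow> 'a\<close>.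
\<close>

definition J_less :: "'k set \<Rightarrow> 'k set set \<Rightarrow> ('k \<Rightarrow> 'a rel) \<Rightarrow> 'l rel \<Rightarrow> 'k set set" where
  "J_less K I lam l =
     {B. B \<subseteq> K \<and>
        \<not> (\<exists>D. ultrafilter_on K D \<and> D \<inter> I = {} \<and> B \<in> D \<and>
             (\<exists>mu :: ('k \<Rightarrow> 'a) rel. prod_is_tcf K lam (dual_ideal K D) mu \<and> l \<le>o mu))}"

definition J_le :: "'k set \<Rightarrow> 'k set set \<Rightarrow> ('k \<Rightarrow> 'a rel) \<Rightarrow> 'l rel \<Rightarrow> 'k set set" where
  "J_le K I lam l = J_less K I lam (cardSuc l)"

end

theory Submission
  imports Defs
begin

text \<open>
  Write \<open>J\<close> for the ideal \<open>J_less K I lam l\<close>. A subset of \<open>K\<close> is outside \<open>J\<close> exactly if it is in some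
  ultrafilter that avoids \<open>I\<close> and has true cofinality at least \<open>l\<close>; in particular \<open>D\<close> avoids \<open>J\<close>.

  Everything rests on one combinatorial fact (\<open>eventual_gap\<close>). For a family of functions \<open>f b\<close>
  with \<open>theta\<^sup>+\<close>-directed index set there is a single \<open>g\<close> in the product such that for every \<open>g'\<close>
  there are arbitrarily late \<open>b\<close> with \<open>g < f b \<le> g'\<close> on a set in \<open>I\<close> only. If there were no such
  \<open>g\<close>, then \<open>theta\<close> steps of a recursion would produce \<open>theta\<close> pairwise disjoint \<open>I\<close>-positive
  sets, although \<open>wsat K I \<le>o theta\<close>. The upper bounds that this recursion needs are taken
  pointwise, and the condition on the liminf makes this possible up to a set in \<open>I\<close>.

  The fact is used twice. First, it shows that the product is \<open>l\<close>-directed modulo \<open>J\<close>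
  (\<open>directed_mod_J_less\<close>): if an increasing sequence were not bounded by \<open>g\<close>, then some ultrafilter
  of true cofinality at least \<open>l\<close> would witness this, and a bound \<open>g'\<close> of the sequence modulo that
  ultrafilter would contradict the choice of \<open>g\<close>. By this directedness, a sequence that is cofinal
  modulo \<open>D\<close> can be replaced by one, \<open>f\<close>, that is moreover strictly increasing modulo \<open>J\<close>.

  Secondly, let \<open>g\<close> be as in the fact for this \<open>f\<close>, and let \<open>a0\<close> be such that \<open>g < f a0\<close> modulo
  \<open>D\<close>. Then \<open>B = {i. g i < f a0 i}\<close> is as required (\<open>exists_generator\<close>): on \<open>B\<close> the later members
  of the sequence stay above \<open>g\<close> modulo \<open>J\<close>, so one that avoids the gap between \<open>g\<close> and \<open>h\<close>
  exceeds \<open>h\<close>. Hence \<open>f\<close> is cofinal on \<open>B\<close> modulo \<open>J\<close>, and no ultrafilter containing \<open>B\<close> and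
  avoiding \<open>J\<close> can have a true cofinality above \<open>l\<close>.
\<close>

section \<open>Cardinals, cofinality and positive sets\<close>

lemma Card_order_copy_into:
  fixes r :: "'x rel" and B :: "'y set"
  assumes r: "Card_order r" and le: "r \<le>o |B|"
  shows "\<exists>B'\<subseteq>B. |B'| =o r"
proof -
  have fr: "|Field r| =o r" using r by (rule card_of_Field_ordIso)
  then have "|Field r| \<le>o |B|" using le by (rule ordIso_ordLeq_trans)
  then obtain B' where B': "B' \<subseteq> B" "|Field r| =o |B'|"
    unfolding internalize_card_of_ordLeq2[of "Field r" B] by blast
  have "|B'| =o r" using ordIso_symmetric[OF B'(2)] fr by (rule ordIso_transitive)
  then show ?thesis using B'(1) by blast
qed

lemma directed_cardD:
  "directed_card P le l \<Longrightarrow> A \<subseteq> P \<Longrightarrow> |A| <o l \<Longrightarrow> \<exists>u\<in>P. \<forall>a\<in>A. le a u"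
  unfolding directed_card_def by simp

text \<open>
  An unbounded set of least size is what proofs of directedness by contradiction start from:
  the order is directed for the size of that set, so recursions along the set can be carried out.
\<close>

lemma minimal_unbounded_set:
  assumes "\<not> directed_card P le l"
  shows "\<exists>F\<subseteq>P. |F| <o l \<and> \<not> (\<exists>u\<in>P. \<forall>a\<in>F. le a u) \<and> directed_card P le |F|"
proof -
  define bad where "bad = {F. F \<subseteq> P \<and> |F| <o l \<and> \<not> (\<exists>u\<in>P. \<forall>a\<in>F. le a u)}"
  have "card_of ` bad \<noteq> {}" using assms unfolding directed_card_def bad_def by auto
  moreover have "\<forall>r\<in>card_of ` bad. Card_order r" by (auto simp: card_of_Card_order)
  ultimately have "\<exists>r\<in>card_of ` bad. \<forall>r'\<in>card_of ` bad. r \<le>o r'"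
    by (rule exists_minim_Card_order)
  then obtain F where "F \<in> bad" and min: "\<And>A. A \<in> bad \<Longrightarrow> |F| \<le>o |A|" by auto
  then have F: "F \<subseteq> P" "|F| <o l" "\<not> (\<exists>u\<in>P. \<forall>a\<in>F. le a u)" unfolding bad_def by simp_all
  have "\<exists>u\<in>P. \<forall>a\<in>A. le a u" if A: "A \<subseteq> P" "|A| <o |F|" for A
  proof (rule ccontr)
    assume "\<not> ?thesis"
    moreover have "|A| <o l" using A(2) F(2) by (rule ordLess_transitive)
    ultimately have "A \<in> bad" using A(1) unfolding bad_def by simp
    then have "|F| \<le>o |A|" by (rule min)
    then show False using not_ordLess_ordLeq[OF A(2)] by simp
  qed
  then have "directed_card P le |F|" unfolding directed_card_def by simp
  then show ?thesis using F by blast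
qed

lemma has_tcf_ordIso:
  assumes "has_tcf P lt le r" and iso: "r =o r'"
  shows "has_tcf P lt le r'"
proof -
  obtain p where r: "Card_order r" and p: "\<And>a. a \<in> Field r \<Longrightarrow> p a \<in> P"
    and inc: "\<And>a b. (a, b) \<in> r - Id \<Longrightarrow> lt (p a) (p b)"
    and cof: "\<And>q. q \<in> P \<Longrightarrow> \<exists>a\<in>Field r. le q (p a)"
    using assms(1) unfolding has_tcf_def by blast
  have r': "Card_order r'" using Card_order_ordIso[OF r ordIso_symmetric[OF iso]] .
  have "r' =o r" using iso by (rule ordIso_symmetric)
  then obtain f where f: "iso r' r f" unfolding ordIso_def by blast
  have bij: "bij_betw f (Field r') (Field r)" using f unfolding iso_def by blast
  have emb: "(f a, f b) \<in> r" if "(a, b) \<in> r'" for a b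
    using f that iso_forward by fastforce
  have "lt (p (f a)) (p (f b))" if ab: "(a, b) \<in> r' - Id" for a b
  proof -
    have "a \<in> Field r'" "b \<in> Field r'" using ab by (auto intro: FieldI1 FieldI2)
    then have "f a \<noteq> f b" using ab bij unfolding bij_betw_def inj_on_def by blast
    then show ?thesis using ab emb inc by blast
  qed
  moreover have "p (f a) \<in> P" if "a \<in> Field r'" for a
    using that bij p unfolding bij_betw_def by blast
  moreover have "\<exists>a\<in>Field r'. le q (p (f a))" if q: "q \<in> P" for q
  proof -
    obtain a where "a \<in> Field r" "le q (p a)" using cof q by blast
    moreover have "Field r = f ` Field r'" using bij unfolding bij_betw_def by blast
    ultimately show ?thesis by auto
  qed
  ultimately show ?thesis unfolding has_tcf_def using r' 
    by (intro conjI exI[of _ "\<lambda>a. p (f a)"]) auto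
qed

lemma is_tcf_has_tcf: "is_tcf P lt le l \<Longrightarrow> has_tcf P lt le l"
  unfolding is_tcf_def is_least_card_def by simp

text \<open>
  The definition of true cofinality compares only cardinals of one type. A smaller candidate of
  any other type would have an isomorphic copy on this one.
\<close>

lemma is_tcf_least:
  fixes l :: "'l rel" and r :: "'m rel"
  assumes l: "is_tcf P lt le l" and r: "has_tcf P lt le r"
  shows "l \<le>o r"
proof (rule ccontr)
  assume *: "\<not> l \<le>o r"
  have cl: "Card_order l"
    and least: "has_tcf P lt le r' \<Longrightarrow> Card_order r' \<Longrightarrow> l \<le>o r'" for r' :: "'l rel"
    using l unfolding is_tcf_def is_least_card_def by simp_all
  have cr: "Card_order r" using r unfolding has_tcf_def by simp
  have "Well_order l" "Well_order r" using cl cr unfolding card_order_on_def by simp_all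
  then have "r <o l" using * by (simp add: not_ordLeq_iff_ordLess)
  moreover have "l =o |Field l|" using card_of_Field_ordIso[OF cl] by (rule ordIso_symmetric)
  ultimately have "r <o |Field l|" by (rule ordLess_ordIso_trans)
  then have "r \<le>o |Field l|" by (rule ordLess_imp_ordLeq)
  then obtain B :: "'l set" where B: "|B| =o r" using Card_order_copy_into[OF cr] by blast
  have "has_tcf P lt le |B|" using has_tcf_ordIso[OF r ordIso_symmetric[OF B]] .
  then have "l \<le>o |B|" using card_of_Card_order by (rule least)
  then have "l \<le>o r" using B by (rule ordLeq_ordIso_trans)
  then show False using * by blast
qed

text \<open>
  Merging the part of \<open>K\<close> outside the family into one of its members turns a disjoint family
  of positive sets into a partition, and a subfamily has exactly the forbidden size \<open>wsat\<close>.
\<close>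

lemma no_disjoint_family_of_positive_sets:
  fixes C :: "'t \<Rightarrow> 'k set"
  assumes I: "proper_ideal_on K I" and theta: "Card_order theta" "wsat K I \<le>o theta"
    and pos: "\<And>\<xi>. \<xi> \<in> Field theta \<Longrightarrow> C \<xi> \<in> positive_sets K I"
    and disj: "\<And>\<xi> \<zeta>. \<xi> \<in> Field theta \<Longrightarrow> \<zeta> \<in> Field theta \<Longrightarrow> \<xi> \<noteq> \<zeta> \<Longrightarrow> C \<xi> \<inter> C \<zeta> = {}"
  shows False
proof -
  define t where "t = wsat K I"
  have t: "Card_order t" "Field t \<noteq> {}"
    and nopart: "\<And>Q. partition_on K Q \<Longrightarrow> Q \<subseteq> positive_sets K I \<Longrightarrow> \<not> |Q| =o t"
    using is_least_card_wsat[of K I] unfolding is_least_card_def t_def by auto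
  have ft: "|Field t| =o t" using t(1) by (rule card_of_Field_ordIso)
  have fth: "theta =o |Field theta|" using card_of_Field_ordIso[OF theta(1)] by (rule ordIso_symmetric)
  have "|Field t| \<le>o |Field theta|"
    using ordLeq_ordIso_trans[OF ordIso_ordLeq_trans[OF ft theta(2)[folded t_def]] fth] .
  then obtain e where e: "inj_on e (Field t)" "e ` Field t \<subseteq> Field theta"
    unfolding card_of_ordLeq[of "Field t" "Field theta", symmetric] by blast
  obtain x0 where x0: "x0 \<in> Field t" using t(2) by blast
  define E where "E x = C (e x) \<union> (if x = x0 then K - (\<Union>y\<in>Field t. C (e y)) else {})" for x
  have sub: "E x \<subseteq> K" if "x \<in> Field t" for x
    using pos e(2) that unfolding E_def positive_sets_def by (auto split: if_splits)
  have Epos: "E x \<in> positive_sets K I" if x: "x \<in> Field t" for x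
  proof -
    have "C (e x) \<notin> I" using pos e(2) x unfolding positive_sets_def by blast
    moreover have "C (e x) \<subseteq> E x" unfolding E_def by blast
    ultimately have "E x \<notin> I"
      using I unfolding proper_ideal_on_def ideal_on_def by blast
    then show ?thesis using sub[OF x] unfolding positive_sets_def by blast
  qed
  have ne: "E x \<noteq> {}" if x: "x \<in> Field t" for x
    using Epos[OF x] I unfolding positive_sets_def proper_ideal_on_def ideal_on_def by auto
  have dj: "E x \<inter> E y = {}" if xy: "x \<in> Field t" "y \<in> Field t" "x \<noteq> y" for x y
  proof -
    have "e x \<noteq> e y" using xy e(1) unfolding inj_on_def by blast
    then have "C (e x) \<inter> C (e y) = {}" using disj e(2) xy by blast
    then show ?thesis using xy unfolding E_def by auto
  qed
  have "inj_on E (Field t)" using dj ne unfolding inj_on_def by (metis Int_absorb)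
  then have "|Field t| =o |E ` Field t|"
    unfolding card_of_ordIso[of "Field t" "E ` Field t", symmetric] bij_betw_def by blast
  from ordIso_transitive[OF ordIso_symmetric[OF this] ft] have "|E ` Field t| =o t" .
  moreover have "partition_on K (E ` Field t)"
  proof (rule partition_onI)
    have "K \<subseteq> (\<Union>x\<in>Field t. E x)"
    proof
      fix i assume "i \<in> K"
      then have "i \<in> E x0 \<or> (\<exists>y\<in>Field t. i \<in> C (e y))" unfolding E_def by auto
      then show "i \<in> (\<Union>x\<in>Field t. E x)" using x0 unfolding E_def by blast
    qed
    then show "\<Union> (E ` Field t) = K" using sub by blast
    show "disjnt p q" if "p \<in> E ` Field t" "q \<in> E ` Field t" "p \<noteq> q" for p q
      using that dj unfolding disjnt_def by auto
    show "{} \<notin> E ` Field t"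
      using ne by blast
  qed
  moreover have "E ` Field t \<subseteq> positive_sets K I" using Epos by blast
  ultimately show False using nopart by blast
qed

section \<open>Ideals and ultrafilters\<close>

lemma ideal_on_subset: "ideal_on K J \<Longrightarrow> A \<in> J \<Longrightarrow> B \<subseteq> A \<Longrightarrow> B \<in> J"
  unfolding ideal_on_def by blast

lemma ideal_on_Un_subset: "ideal_on K J \<Longrightarrow> A \<in> J \<Longrightarrow> B \<in> J \<Longrightarrow> C \<subseteq> A \<union> B \<Longrightarrow> C \<in> J"
  unfolding ideal_on_def by blast

lemma ultrafilter_on_mono: "ultrafilter_on K D \<Longrightarrow> A \<in> D \<Longrightarrow> A \<subseteq> B \<Longrightarrow> B \<subseteq> K \<Longrightarrow> B \<in> D"
  unfolding ultrafilter_on_def by blast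

lemma ultrafilter_on_Int: "ultrafilter_on K D \<Longrightarrow> A \<in> D \<Longrightarrow> B \<in> D \<Longrightarrow> A \<inter> B \<in> D"
  unfolding ultrafilter_on_def by blast

lemma ultrafilter_on_compl: "ultrafilter_on K D \<Longrightarrow> A \<subseteq> K \<Longrightarrow> K - A \<in> D \<longleftrightarrow> A \<notin> D"
  unfolding ultrafilter_on_def by (metis Diff_disjoint)

lemma ideal_on_dual_ideal:
  assumes "ultrafilter_on K D" shows "ideal_on K (dual_ideal K D)"
proof -
  have "K - (A \<union> B) \<in> D" if "K - A \<in> D" "K - B \<in> D" for A B
  proof -
    have "K - (A \<union> B) = (K - A) \<inter> (K - B)" by blast
    then show ?thesis using ultrafilter_on_Int[OF assms that] by simp
  qed
  moreover have "K - B \<in> D" if "K - A \<in> D" "B \<subseteq> A" for A B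
    using ultrafilter_on_mono[OF assms that(1), of "K - B"] that(2) by blast
  moreover have "K \<in> D" using assms unfolding ultrafilter_on_def by blast
  ultimately show ?thesis unfolding ideal_on_def dual_ideal_def by auto
qed

lemma subset_dual_ideal:
  assumes "ultrafilter_on K D" "J \<subseteq> Pow K" "D \<inter> J = {}"
  shows "J \<subseteq> dual_ideal K D"
  using assms ultrafilter_on_compl[OF assms(1)] unfolding dual_ideal_def by blast

lemma less_mod_dual_ideal:
  assumes "ultrafilter_on K D"
  shows "less_mod K lam (dual_ideal K D) f g \<longleftrightarrow> {i \<in> K. (f i, g i) \<in> lam i - Id} \<in> D"
proof -
  have "K - {i \<in> K. (f i, g i) \<notin> lam i - Id} = {i \<in> K. (f i, g i) \<in> lam i - Id}" by blast
  then show ?thesis unfolding less_mod_def dual_ideal_def by auto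
qed

lemma le_mod_dual_ideal:
  assumes "ultrafilter_on K D"
  shows "le_mod K lam (dual_ideal K D) f g \<longleftrightarrow> {i \<in> K. (f i, g i) \<in> lam i} \<in> D"
proof -
  have "K - {i \<in> K. (f i, g i) \<notin> lam i} = {i \<in> K. (f i, g i) \<in> lam i}" by blast
  then show ?thesis unfolding le_mod_def dual_ideal_def by auto
qed

lemma le_mod_mono: "J \<subseteq> J' \<Longrightarrow> le_mod B lam J f g \<Longrightarrow> le_mod B lam J' f g"
  unfolding le_mod_def by blast

lemma less_mod_imp_le_mod: "ideal_on K J \<Longrightarrow> less_mod K lam J f g \<Longrightarrow> le_mod K lam J f g"
  unfolding less_mod_def le_mod_def by (auto elim!: ideal_on_subset)

lemma J_less_disjoint:
  fixes lam :: "'k \<Rightarrow> 'a rel" and mu :: "('k \<Rightarrow> 'a) rel"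
  assumes "ultrafilter_on K D" "D \<inter> I = {}" "prod_is_tcf K lam (dual_ideal K D) mu" "l \<le>o mu"
  shows "D \<inter> J_less K I lam l = {}"
  using assms unfolding J_less_def by blast

lemma J_less_subset_Pow: "J_less K I lam l \<subseteq> Pow K"
  unfolding J_less_def by blast

lemma ideal_subset_J_less:
  assumes "ideal_on K I" shows "I \<subseteq> J_less K I lam l"
proof
  fix B assume B: "B \<in> I"
  then have "B \<subseteq> K" using assms unfolding ideal_on_def by blast
  moreover have "\<forall>D. B \<in> D \<longrightarrow> D \<inter> I \<noteq> {}" using B by blast
  ultimately show "B \<in> J_less K I lam l" unfolding J_less_def by simp
qed

lemma ideal_on_J_less:
  fixes lam :: "'k \<Rightarrow> 'a rel"
  shows "ideal_on K (J_less K I lam l)"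
proof -
  define U where "U = {D. ultrafilter_on K D \<and> D \<inter> I = {} \<and>
    (\<exists>mu :: ('k \<Rightarrow> 'a) rel. prod_is_tcf K lam (dual_ideal K D) mu \<and> l \<le>o mu)}"
  define J where "J = J_less K I lam l"
  have J_iff: "B \<in> J \<longleftrightarrow> B \<subseteq> K \<and> (\<forall>D\<in>U. B \<notin> D)" for B
    unfolding J_def J_less_def U_def by auto
  have U: "ultrafilter_on K D" if "D \<in> U" for D using that unfolding U_def by simp
  have "{} \<in> J" unfolding J_iff using U unfolding ultrafilter_on_def by simp
  moreover have "B \<in> J" if A: "A \<in> J" and B: "B \<subseteq> A" for A B
    using A B ultrafilter_on_mono[OF U _ B] unfolding J_iff by blast
  moreover have "A \<union> B \<in> J" if A: "A \<in> J" and B: "B \<in> J" for A B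
  proof -
    have "A \<union> B \<notin> D" if D: "D \<in> U" for D
    proof
      assume AB: "A \<union> B \<in> D"
      have "K - A \<in> D" "K - B \<in> D"
        using A B D ultrafilter_on_compl[OF U[OF D]] unfolding J_iff by simp_all
      then have "(K - A) \<inter> (K - B) \<inter> (A \<union> B) \<in> D"
        using AB by (intro ultrafilter_on_Int[OF U[OF D]])
      moreover have "(K - A) \<inter> (K - B) \<inter> (A \<union> B) = {}" by blast
      ultimately show False using U[OF D] unfolding ultrafilter_on_def by simp
    qed
    then show ?thesis using A B unfolding J_iff by blast
  qed
  moreover have "J \<subseteq> Pow K" unfolding J_def by (rule J_less_subset_Pow)
  ultimately show ?thesis unfolding J_def[symmetric] ideal_on_def by blast
qed

section \<open>Products of infinite regular cardinals\<close>

locale regular_product =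
  fixes K :: "'k set" and lam :: "'k \<Rightarrow> 'a rel"
  assumes lam: "i \<in> K \<Longrightarrow> Cinfinite (lam i) \<and> regularCard (lam i)"
begin

lemma lam_Card_order: "i \<in> K \<Longrightarrow> Card_order (lam i)"
  using lam by blast

lemma lam_total: "i \<in> K \<Longrightarrow> x \<in> Field (lam i) \<Longrightarrow> y \<in> Field (lam i) \<Longrightarrow> (x, y) \<notin> lam i \<Longrightarrow> (y, x) \<in> lam i - Id"
  using lam_Card_order[of i] wo_rel.TOTALS[of "lam i"] wo_rel.REFL[of "lam i"]
  unfolding card_order_on_def wo_rel_def refl_on_def by blast

lemma lam_refl: "i \<in> K \<Longrightarrow> x \<in> Field (lam i) \<Longrightarrow> (x, x) \<in> lam i"
  using lam_total by blast

lemma lam_trans: "i \<in> K \<Longrightarrow> (x, y) \<in> lam i \<Longrightarrow> (y, z) \<in> lam i \<Longrightarrow> (x, z) \<in> lam i"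
  using lam_Card_order[of i] wo_rel.TRANS[of "lam i"]
  unfolding card_order_on_def wo_rel_def trans_def by blast

lemma lam_antisym: "i \<in> K \<Longrightarrow> (x, y) \<in> lam i \<Longrightarrow> (y, x) \<in> lam i \<Longrightarrow> x = y"
  using lam_Card_order[of i] wo_rel.ANTISYM[of "lam i"]
  unfolding card_order_on_def wo_rel_def antisym_def by blast

lemma lam_le_less_trans:
  "i \<in> K \<Longrightarrow> (x, y) \<in> lam i \<Longrightarrow> (y, z) \<in> lam i - Id \<Longrightarrow> (x, z) \<in> lam i - Id"
  using lam_trans lam_antisym by blast

lemma lam_less_le_trans:
  "i \<in> K \<Longrightarrow> (x, y) \<in> lam i - Id \<Longrightarrow> (y, z) \<in> lam i \<Longrightarrow> (x, z) \<in> lam i - Id"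
  using lam_trans lam_antisym by blast

lemma lam_bounded:
  assumes i: "i \<in> K" and A: "A \<subseteq> Field (lam i)" "|A| <o lam i"
  shows "\<exists>b\<in>Field (lam i). \<forall>a\<in>A. (a, b) \<in> lam i"
proof -
  have "\<not> |A| =o lam i" using A(2) by (rule not_ordLess_ordIso)
  then have "\<not> cofinal A (lam i)" using lam[OF i] A(1) unfolding regularCard_def by blast
  then obtain b where b: "b \<in> Field (lam i)" and *: "\<And>a. a \<in> A \<Longrightarrow> b = a \<or> (b, a) \<notin> lam i"
    unfolding cofinal_def by blast
  have "(a, b) \<in> lam i" if "a \<in> A" for a
    using *[OF that] lam_total[OF i b, of a] lam_refl[OF i b] A(1) that by blast
  then show ?thesis using b by blast
qed

lemma lam_greater:
  assumes i: "i \<in> K" and x: "x \<in> Field (lam i)" and y: "y \<in> Field (lam i)"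
  shows "\<exists>z\<in>Field (lam i). (x, z) \<in> lam i - Id \<and> (y, z) \<in> lam i - Id"
proof -
  have up: "\<exists>z\<in>Field (lam i). (w, z) \<in> lam i - Id" if "w \<in> Field (lam i)" for w
    using infinite_Card_order_limit[of "lam i" w] lam[OF i] that
    unfolding cinfinite_def by blast
  show ?thesis
  proof (cases "(x, y) \<in> lam i")
    case True
    then show ?thesis using up[OF y] lam_le_less_trans[OF i] by blast
  next
    case False
    then have "(y, x) \<in> lam i" using lam_total[OF i x y] by blast
    then show ?thesis using up[OF x] lam_le_less_trans[OF i] by blast
  qed
qed

lemma card_prod_mem: "f \<in> card_prod K lam \<Longrightarrow> i \<in> K \<Longrightarrow> f i \<in> Field (lam i)"
  unfolding card_prod_def by (rule PiE_mem)

lemma card_prod_choice: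
  assumes "\<And>i. i \<in> K \<Longrightarrow> \<exists>z\<in>Field (lam i). P i z"
  shows "\<exists>w\<in>card_prod K lam. \<forall>i\<in>K. P i (w i)"
proof -
  have "\<forall>i\<in>K. \<exists>z. z \<in> Field (lam i) \<and> P i z" using assms by blast
  then obtain w where "\<forall>i\<in>K. w i \<in> Field (lam i) \<and> P i (w i)" by (meson bchoice)
  then have "restrict w K \<in> card_prod K lam" "\<forall>i\<in>K. P i (restrict w K i)"
    unfolding card_prod_def by auto
  then show ?thesis by blast
qed

lemma card_prod_nonempty: "card_prod K lam \<noteq> {}"
proof -
  have "\<exists>z\<in>Field (lam i). True" if "i \<in> K" for i
    using lam[OF that] unfolding cinfinite_def by (metis finite.emptyI ex_in_conv)
  then show ?thesis using card_prod_choice[of "\<lambda>_ _. True"] by blast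
qed

lemma card_prod_greater:
  assumes "u \<in> card_prod K lam" "v \<in> card_prod K lam"
  shows "\<exists>w\<in>card_prod K lam. \<forall>i\<in>K. (u i, w i) \<in> lam i - Id \<and> (v i, w i) \<in> lam i - Id"
  using assms by (intro card_prod_choice lam_greater card_prod_mem)

lemma le_mod_trans:
  assumes "ideal_on K J" "le_mod K lam J f g" "le_mod K lam J g h"
  shows "le_mod K lam J f h"
proof -
  have "{i \<in> K. (f i, h i) \<notin> lam i} \<subseteq> {i \<in> K. (f i, g i) \<notin> lam i} \<union> {i \<in> K. (g i, h i) \<notin> lam i}"
    using lam_trans by blast
  then have "{i \<in> K. (f i, h i) \<notin> lam i} \<in> J"
    using assms unfolding le_mod_def by (meson IntD1 ideal_on_Un_subset)
  then show ?thesis unfolding le_mod_def by blast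
qed

lemma le_mod_pointwise:
  assumes "ideal_on K J" "\<And>i. i \<in> K \<Longrightarrow> (f i, g i) \<in> lam i"
  shows "le_mod K lam J f g"
proof -
  have empty: "{i \<in> K. (f i, g i) \<notin> lam i} = {}" using assms(2) by blast
  show ?thesis using assms(1) unfolding le_mod_def ideal_on_def empty by simp
qed

lemma le_less_mod_pointwise:
  assumes J: "ideal_on K J" and "le_mod K lam J f g"
    and gh: "\<And>i. i \<in> K \<Longrightarrow> (g i, h i) \<in> lam i - Id"
  shows "less_mod K lam J f h"
proof -
  have "{i \<in> K. (f i, h i) \<notin> lam i - Id} \<subseteq> {i \<in> K. (f i, g i) \<notin> lam i}"
    using gh lam_le_less_trans by blast
  then have "{i \<in> K. (f i, h i) \<notin> lam i - Id} \<in> J"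
    using assms(1,2) unfolding le_mod_def by (meson IntD1 ideal_on_subset)
  then show ?thesis unfolding less_mod_def by blast
qed

lemma less_le_mod_dual_contradiction:
  assumes D: "ultrafilter_on K D"
    and "less_mod K lam (dual_ideal K D) f g" "le_mod K lam (dual_ideal K D) g f"
  shows False
proof -
  have "{i \<in> K. (f i, g i) \<in> lam i - Id} \<inter> {i \<in> K. (g i, f i) \<in> lam i} \<in> D"
    using assms by (simp add: less_mod_dual_ideal le_mod_dual_ideal ultrafilter_on_Int)
  moreover have "{i \<in> K. (f i, g i) \<in> lam i - Id} \<inter> {i \<in> K. (g i, f i) \<in> lam i} = {}"
    using lam_antisym by blast
  ultimately show False using D unfolding ultrafilter_on_def by simp
qed

lemma dual_ideal_linear:
  assumes D: "ultrafilter_on K D" and f: "f \<in> card_prod K lam" and g: "g \<in> card_prod K lam"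
    and not_le: "\<not> le_mod K lam (dual_ideal K D) f g"
  shows "less_mod K lam (dual_ideal K D) g f"
proof -
  have "{i \<in> K. (f i, g i) \<in> lam i} \<notin> D" using not_le D by (simp add: le_mod_dual_ideal)
  then have "K - {i \<in> K. (f i, g i) \<in> lam i} \<in> D" using D by (simp add: ultrafilter_on_compl)
  moreover have "K - {i \<in> K. (f i, g i) \<in> lam i} \<subseteq> {i \<in> K. (g i, f i) \<in> lam i - Id}"
    using lam_total f g card_prod_mem by blast
  ultimately have "{i \<in> K. (g i, f i) \<in> lam i - Id} \<in> D"
    by (rule ultrafilter_on_mono[OF D]) blast
  then show ?thesis using D by (simp add: less_mod_dual_ideal)
qed

text \<open>
  A product that is directed for \<open>r\<close> allows a recursion along \<open>r\<close>: at each step the fewer than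
  \<open>r\<close> earlier values have a bound modulo \<open>J\<close>, and it is raised strictly above the prescribed
  function, so the family can be replaced by an increasing one that dominates it.
\<close>

lemma increasing_majorants:
  assumes J: "ideal_on K J" and r: "Card_order r"
    and dir: "directed_card (card_prod K lam) (le_mod K lam J) r"
    and p: "\<And>a. a \<in> Field r \<Longrightarrow> p a \<in> card_prod K lam"
  shows "\<exists>f. (\<forall>a\<in>Field r. f a \<in> card_prod K lam \<and> (\<forall>i\<in>K. (p a i, f a i) \<in> lam i)) \<and>
     (\<forall>a b. (a, b) \<in> r - Id \<longrightarrow> less_mod K lam J (f a) (f b))"
proof -
  let ?good = "\<lambda>f b x. b \<in> Field r \<longrightarrow> x \<in> card_prod K lam \<and> (\<forall>i\<in>K. (p b i, x i) \<in> lam i) \<and>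
     (\<forall>a. (a, b) \<in> r - Id \<longrightarrow> less_mod K lam J (f a) x)"
  have "\<exists>f. \<forall>b. ?good f b (f b)"
  proof (rule dependent_wf_choice)
    show "wf (r - Id)"
      using r unfolding card_order_on_def well_order_on_def by blast
    show "?good f b x = ?good g b x" if "\<And>a. (a, b) \<in> r - Id \<Longrightarrow> f a = g a" for f g b x
      using that by simp
    show "\<exists>x. ?good f b x" if IH: "\<And>a. (a, b) \<in> r - Id \<Longrightarrow> ?good f a (f a)" for b f
    proof (cases "b \<in> Field r")
      case b: True
      have "f ` underS r b \<subseteq> card_prod K lam"
        using IH unfolding underS_def by (auto intro: FieldI1)
      moreover have "|f ` underS r b| <o r"
        using card_of_image card_of_underS[OF r b] by (rule ordLeq_ordLess_trans)
      ultimately obtain u where u: "u \<in> card_prod K lam" 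
        and bd: "\<And>a. a \<in> underS r b \<Longrightarrow> le_mod K lam J (f a) u"
        using directed_cardD[OF dir, of "f ` underS r b"] by blast
      obtain w where w: "w \<in> card_prod K lam"
        and uw: "\<And>i. i \<in> K \<Longrightarrow> (u i, w i) \<in> lam i - Id \<and> (p b i, w i) \<in> lam i - Id"
        using card_prod_greater[OF u p[OF b]] by blast
      have "less_mod K lam J (f a) w" if "(a, b) \<in> r - Id" for a
        using bd[of a] that uw unfolding underS_def by (auto intro: le_less_mod_pointwise[OF J])
      then show ?thesis using w uw by blast
    qed blast
  qed
  then show ?thesis by (metis DiffD1 FieldI2)
qed

text \<open>
  Modulo an ultrafilter an unbounded set is cofinal. If a least counterexample had size below the
  true cofinality, its members in an enumeration could be replaced by increasing majorants,
  giving a cofinal sequence that is too short.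
\<close>

lemma directed_below_tcf:
  fixes mu :: "'m rel"
  assumes D: "ultrafilter_on K D" and tcf: "prod_is_tcf K lam (dual_ideal K D) mu"
  shows "directed_card (card_prod K lam) (le_mod K lam (dual_ideal K D)) mu"
proof (rule ccontr)
  let ?P = "card_prod K lam" and ?J = "dual_ideal K D"
  note J = ideal_on_dual_ideal[OF D]
  assume "\<not> ?thesis"
  from minimal_unbounded_set[OF this]
  obtain F where F: "F \<subseteq> ?P" "|F| <o mu" "\<not> (\<exists>u\<in>?P. \<forall>a\<in>F. le_mod K lam ?J a u)"
    and dir: "directed_card ?P (le_mod K lam ?J) |F|"
    by blast
  have "\<And>a. a \<in> Field |F| \<Longrightarrow> a \<in> ?P" using F(1) by (auto simp: Field_card_of)
  from increasing_majorants[where p = "\<lambda>a. a", OF J card_of_Card_order dir this]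
  obtain f where f: "\<And>a. a \<in> F \<Longrightarrow> f a \<in> ?P \<and> (\<forall>i\<in>K. (a i, f a i) \<in> lam i)"
    and inc: "\<And>a b. (a, b) \<in> |F| - Id \<Longrightarrow> less_mod K lam ?J (f a) (f b)"
    by (auto simp: Field_card_of)
  have "\<exists>a\<in>F. le_mod K lam ?J q (f a)" if q: "q \<in> ?P" for q
  proof -
    obtain a where a: "a \<in> F" "\<not> le_mod K lam ?J a q" using F(3) q by blast
    then have "le_mod K lam ?J q a"
      using dual_ideal_linear[OF D, of a q] F(1) q less_mod_imp_le_mod[OF J] by blast
    moreover have "le_mod K lam ?J a (f a)" using f[OF a(1)] le_mod_pointwise[OF J] by blast
    ultimately show ?thesis using le_mod_trans[OF J] a(1) by blast
  qed
  then have "prod_has_tcf K lam ?J |F|"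
    unfolding has_tcf_def using f inc card_of_Card_order[of F] by (auto simp: Field_card_of)
  then have "mu \<le>o |F|" by (rule is_tcf_least[OF tcf])
  then show False using not_ordLess_ordLeq[OF F(2)] by simp
qed

text \<open>
  A strictly increasing sequence modulo an ultrafilter is injective, so it serves to copy the
  cardinal onto the type over which the pcf ideals quantify.
\<close>

lemma tcf_copy:
  fixes l :: "'l rel"
  assumes D: "ultrafilter_on K D" and tcf: "prod_is_tcf K lam (dual_ideal K D) l"
  shows "\<exists>mu :: ('k \<Rightarrow> 'a) rel. prod_is_tcf K lam (dual_ideal K D) mu \<and> l \<le>o mu"
proof -
  let ?J = "dual_ideal K D"
  have has: "prod_has_tcf K lam ?J l" using tcf by (rule is_tcf_has_tcf)
  obtain p where l: "Card_order l" and p: "\<And>a. a \<in> Field l \<Longrightarrow> p a \<in> card_prod K lam"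
    and inc: "\<And>a b. (a, b) \<in> l - Id \<Longrightarrow> less_mod K lam ?J (p a) (p b)"
    using has unfolding has_tcf_def by blast
  have irr: "p a \<noteq> p b" if "(a, b) \<in> l - Id" "a \<in> Field l" for a b
  proof
    assume "p a = p b"
    then have "less_mod K lam ?J (p a) (p a)" using inc[OF that(1)] by simp
    moreover have "le_mod K lam ?J (p a) (p a)"
      using le_mod_pointwise[OF ideal_on_dual_ideal[OF D]] lam_refl card_prod_mem p that(2) by blast
    ultimately show False by (rule less_le_mod_dual_contradiction[OF D])
  qed
  have tot: "(a, b) \<in> l \<or> (b, a) \<in> l" if "a \<in> Field l" "b \<in> Field l" for a b
    using l wo_rel.TOTALS[of l] that unfolding card_order_on_def wo_rel_def by blast
  have "inj_on p (Field l)"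
  proof (rule inj_onI, rule ccontr)
    fix a b assume ab: "a \<in> Field l" "b \<in> Field l" "p a = p b" "a \<noteq> b"
    then have "(a, b) \<in> l - Id \<or> (b, a) \<in> l - Id" using tot by blast
    then show False using irr ab by metis
  qed
  then have "|Field l| =o |p ` Field l|"
    unfolding card_of_ordIso[of "Field l" "p ` Field l", symmetric] bij_betw_def by blast
  from ordIso_transitive[OF ordIso_symmetric[OF card_of_Field_ordIso[OF l]] this]
  have iso: "l =o |p ` Field l|" .
  have "prod_is_tcf K lam ?J |p ` Field l|"
    unfolding is_tcf_def is_least_card_def
  proof (intro conjI allI impI card_of_Card_order)
    show "prod_has_tcf K lam ?J |p ` Field l|" using has_tcf_ordIso[OF has iso] .
    fix r :: "('k \<Rightarrow> 'a) rel" assume "Card_order r \<and> prod_has_tcf K lam ?J r"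
    then have "l \<le>o r" using is_tcf_least[OF tcf, of r] by simp
    then show "|p ` Field l| \<le>o r" by (rule ordIso_ordLeq_trans[OF ordIso_symmetric[OF iso]])
  qed
  then show ?thesis using ordIso_imp_ordLeq[OF iso] by blast
qed

end

section \<open>The gap lemma and directedness modulo the pcf ideals\<close>

locale pcf_product = regular_product K lam
  for K :: "'k set" and lam :: "'k \<Rightarrow> 'a rel" +
  fixes I :: "'k set set" and theta :: "'t rel"
  assumes I: "proper_ideal_on K I"
    and theta: "Card_order theta"
    and wsat_le: "wsat K I \<le>o theta"
    and le_liminf: "theta \<le>o liminf_card K I lam"
    and directed: "directed_card (card_prod K lam) (le_mod K lam I) (cardSuc theta)"
begin

lemma ideal: "ideal_on K I"
  using I unfolding proper_ideal_on_def by blast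

text \<open>
  The candidates for the liminf are cardinals on the type of the factors, so the size of an initial
  segment of \<open>theta\<close> has to be copied there before it can be compared with them.
\<close>

lemma few_small_factors:
  assumes "\<xi> \<in> Field theta"
  shows "{i \<in> K. \<not> |underS theta \<xi>| <o lam i} \<in> I"
proof (rule ccontr)
  assume not: "\<not> ?thesis"
  let ?L = "liminf_card K I lam"
  have L: "is_least_card (\<lambda>mu. {i \<in> K. lam i \<le>o mu} \<in> positive_sets K I) ?L"
    using I lam_Card_order by (rule is_least_card_liminf_card)
  then have cL: "Card_order ?L" unfolding is_least_card_def by simp
  have less: "|underS theta \<xi>| <o ?L"
    using card_of_underS[OF theta assms] le_liminf by (rule ordLess_ordLeq_trans)
  have "?L =o |Field ?L|" using card_of_Field_ordIso[OF cL] by (rule ordIso_symmetric)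
  from ordLess_imp_ordLeq[OF ordLess_ordIso_trans[OF less this]]
  have "|underS theta \<xi>| \<le>o |Field ?L|" .
  then obtain B :: "'a set" where B: "|B| =o |underS theta \<xi>|"
    using Card_order_copy_into[OF card_of_Card_order] by blast
  have "{i \<in> K. \<not> |underS theta \<xi>| <o lam i} \<subseteq> {i \<in> K. lam i \<le>o |B|}"
  proof clarify
    fix i assume i: "i \<in> K" "\<not> |underS theta \<xi>| <o lam i"
    have "Well_order (lam i)" using lam_Card_order[OF i(1)] unfolding card_order_on_def by simp
    then have "lam i \<le>o |underS theta \<xi>|"
      using i(2) by (simp add: not_ordLess_iff_ordLeq card_of_Well_order)
    then show "lam i \<le>o |B|" using ordIso_symmetric[OF B] by (rule ordLeq_ordIso_trans)
  qed
  then have "{i \<in> K. lam i \<le>o |B|} \<notin> I" using not ideal_on_subset[OF ideal] by blast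
  then have "{i \<in> K. lam i \<le>o |B|} \<in> positive_sets K I" unfolding positive_sets_def by blast
  then have "?L \<le>o |B|" using L card_of_Card_order[of B] unfolding is_least_card_def by simp
  then have "?L \<le>o |underS theta \<xi>|" using B by (rule ordLeq_ordIso_trans)
  then show False using not_ordLess_ordLeq[OF less] by simp
qed

text \<open>
  Suppose every \<open>g\<close> had a counterexample \<open>g'\<close>. Iterating \<open>g \<mapsto> g'\<close> along \<open>theta\<close>, each time
  starting from a function that bounds the earlier \<open>g'\<close> in every coordinate \<open>i\<close> where they are
  fewer than \<open>lam i\<close>, one gets \<open>theta\<close> intervals \<open>(g, g']\<close>. For one index \<open>b\<close> beyond all the
  counterexample indices, the value of \<open>f b\<close> lies in the \<open>\<xi>\<close>-th interval on a positive set, and it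
  remains positive without the coordinates where no bound was taken. There the intervals lie one
  above the other, so the resulting sets are disjoint and contradict the bound on \<open>wsat\<close>.
\<close>

lemma eventual_gap:
  assumes X: "directed_card X le (cardSuc theta)"
  shows "\<exists>g\<in>card_prod K lam. \<forall>g'\<in>card_prod K lam. \<forall>a\<in>X. \<exists>b\<in>X. le a b \<and>
     {i \<in> K. (g i, f b i) \<in> lam i - Id \<and> (f b i, g' i) \<in> lam i} \<in> I"
proof (rule ccontr)
  let ?P = "card_prod K lam"
  assume "\<not> ?thesis"
  then have "\<forall>g\<in>?P. \<exists>s. fst s \<in> ?P \<and> snd s \<in> X \<and> (\<forall>b\<in>X. le (snd s) b \<longrightarrow>
     {i \<in> K. (g i, f b i) \<in> lam i - Id \<and> (f b i, fst s i) \<in> lam i} \<notin> I)"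
    by (simp add: Bex_def) blast
  from bchoice[OF this] obtain s where s: "\<And>g. g \<in> ?P \<Longrightarrow> fst (s g) \<in> ?P \<and> snd (s g) \<in> X \<and>
     (\<forall>b\<in>X. le (snd (s g)) b \<longrightarrow>
     {i \<in> K. (g i, f b i) \<in> lam i - Id \<and> (f b i, fst (s g) i) \<in> lam i} \<notin> I)"
    by blast
  \<comment> \<open>The first component of \<open>s g\<close> is the counterexample \<open>g'\<close>, the second the index from which on it works.\<close>
  let ?H = "\<lambda>g. fst (s g)"
  let ?good = "\<lambda>G \<xi> g. \<xi> \<in> Field theta \<longrightarrow> g \<in> ?P \<and> (\<forall>i\<in>K. |underS theta \<xi>| <o lam i \<longrightarrow>
     (\<forall>\<zeta>. (\<zeta>, \<xi>) \<in> theta - Id \<longrightarrow> (?H (G \<zeta>) i, g i) \<in> lam i))"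
  have "\<exists>G. \<forall>\<xi>. ?good G \<xi> (G \<xi>)"
  proof (rule dependent_wf_choice)
    show "wf (theta - Id)"
      using theta unfolding card_order_on_def well_order_on_def by blast
    show "?good G \<xi> g = ?good G' \<xi> g" if "\<And>\<zeta>. (\<zeta>, \<xi>) \<in> theta - Id \<Longrightarrow> G \<zeta> = G' \<zeta>" for G G' \<xi> g
      using that by simp
    show "\<exists>g. ?good G \<xi> g" if IH: "\<And>\<zeta>. (\<zeta>, \<xi>) \<in> theta - Id \<Longrightarrow> ?good G \<zeta> (G \<zeta>)" for \<xi> G
    proof -
      have GP: "G \<zeta> \<in> ?P" if "\<zeta> \<in> underS theta \<xi>" for \<zeta>
        using IH[of \<zeta>] that unfolding underS_def by (auto intro: FieldI1)
      have "\<exists>w\<in>?P. \<forall>i\<in>K. |underS theta \<xi>| <o lam i \<longrightarrow>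
          (\<forall>\<zeta>\<in>underS theta \<xi>. (?H (G \<zeta>) i, w i) \<in> lam i)"
      proof (rule card_prod_choice)
        fix i assume i: "i \<in> K"
        show "\<exists>z\<in>Field (lam i). |underS theta \<xi>| <o lam i \<longrightarrow>
          (\<forall>\<zeta>\<in>underS theta \<xi>. (?H (G \<zeta>) i, z) \<in> lam i)"
        proof (cases "|underS theta \<xi>| <o lam i")
          case True
          let ?A = "(\<lambda>\<zeta>. ?H (G \<zeta>) i) ` underS theta \<xi>"
          have "?A \<subseteq> Field (lam i)" using GP s card_prod_mem[OF _ i] by blast
          moreover have "|?A| <o lam i" using card_of_image True by (rule ordLeq_ordLess_trans)
          ultimately show ?thesis using lam_bounded[OF i, of ?A] by blast
        next
          case False
          then show ?thesis using card_prod_nonempty card_prod_mem[OF _ i] by blast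
        qed
      qed
      then show ?thesis unfolding underS_def by blast
    qed
  qed
  then obtain G where G: "\<And>\<xi>. \<xi> \<in> Field theta \<Longrightarrow> G \<xi> \<in> ?P"
    and up: "\<And>\<zeta> \<xi> i. (\<zeta>, \<xi>) \<in> theta - Id \<Longrightarrow> i \<in> K \<Longrightarrow> |underS theta \<xi>| <o lam i \<Longrightarrow>
      (?H (G \<zeta>) i, G \<xi> i) \<in> lam i"
    by (metis DiffD1 FieldI2)
  let ?S = "(\<lambda>\<xi>. snd (s (G \<xi>))) ` Field theta"
  have "|?S| \<le>o theta"
    using card_of_image card_of_Field_ordIso[OF theta] by (rule ordLeq_ordIso_trans)
  then have "|?S| <o cardSuc theta"
    unfolding cardSuc_ordLeq_ordLess[OF theta card_of_Card_order] .
  moreover have "?S \<subseteq> X" using s G by blast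
  ultimately obtain b where b: "b \<in> X" "\<And>\<xi>. \<xi> \<in> Field theta \<Longrightarrow> le (snd (s (G \<xi>))) b"
    using directed_cardD[OF X, of ?S] by blast
  define C where "C \<xi> = {i \<in> K. |underS theta \<xi>| <o lam i \<and>
    (G \<xi> i, f b i) \<in> lam i - Id \<and> (f b i, ?H (G \<xi>) i) \<in> lam i}" for \<xi>
  show False
  proof (rule no_disjoint_family_of_positive_sets[OF I theta wsat_le])
    fix \<xi> assume \<xi>: "\<xi> \<in> Field theta"
    let ?gap = "{i \<in> K. (G \<xi> i, f b i) \<in> lam i - Id \<and> (f b i, ?H (G \<xi>) i) \<in> lam i}"
    have "?gap \<notin> I" using s[OF G[OF \<xi>]] b \<xi> by blast
    moreover have "?gap \<subseteq> {i \<in> K. \<not> |underS theta \<xi>| <o lam i} \<union> C \<xi>"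
      unfolding C_def by blast
    ultimately have "C \<xi> \<notin> I"
      using few_small_factors[OF \<xi>] ideal_on_Un_subset[OF ideal] by blast
    then show "C \<xi> \<in> positive_sets K I" unfolding positive_sets_def C_def by blast
  next
    have disj: "C \<zeta> \<inter> C \<xi> = {}" if "(\<zeta>, \<xi>) \<in> theta - Id" for \<zeta> \<xi>
    proof (rule ccontr)
      assume "\<not> ?thesis"
      then obtain i where i: "i \<in> K" "|underS theta \<xi>| <o lam i"
        "(f b i, ?H (G \<zeta>) i) \<in> lam i" "(G \<xi> i, f b i) \<in> lam i - Id"
        unfolding C_def by blast
      have "(f b i, G \<xi> i) \<in> lam i" using lam_trans[OF i(1) i(3) up[OF that i(1,2)]] .
      then show False using i(4) lam_antisym[OF i(1)] by blast
    qed
    fix \<xi> \<zeta> assume "\<xi> \<in> Field theta" "\<zeta> \<in> Field theta" "\<xi> \<noteq> \<zeta>"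
    then have "(\<zeta>, \<xi>) \<in> theta - Id \<or> (\<xi>, \<zeta>) \<in> theta - Id"
      using theta wo_rel.TOTALS[of theta] unfolding card_order_on_def wo_rel_def by blast
    then show "C \<xi> \<inter> C \<zeta> = {}" using disj by blast
  qed
qed

text \<open>
  A least unbounded set can be replaced by an increasing sequence \<open>f\<close> whose index set is
  \<open>theta\<^sup>+\<close>-directed: the values of \<open>f\<close> at any \<open>theta\<close> indices are bounded modulo \<open>I\<close>, so these
  indices cannot be cofinal. The function \<open>g\<close> of the gap lemma bounds \<open>f\<close>. Otherwise \<open>g < f a\<close>
  on a positive set, hence modulo some ultrafilter of true cofinality at least \<open>l\<close>; modulo this
  ultrafilter \<open>f\<close> has a bound \<open>h\<close>, and every \<open>f b\<close> with \<open>b\<close> above \<open>a\<close> falls into the gap from \<open>g\<close> to \<open>h\<close>.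
\<close>

lemma directed_mod_J_less:
  fixes l :: "'l rel"
  shows "directed_card (card_prod K lam) (le_mod K lam (J_less K I lam l)) l"
proof (rule ccontr)
  let ?P = "card_prod K lam"
  define J where "J = J_less K I lam l"
  have J: "ideal_on K J" and IJ: "I \<subseteq> J"
    unfolding J_def using ideal_on_J_less ideal_subset_J_less[OF ideal] by blast+
  assume "\<not> ?thesis"
  from minimal_unbounded_set[OF this[folded J_def]]
  obtain F where F: "F \<subseteq> ?P" "|F| <o l" "\<not> (\<exists>u\<in>?P. \<forall>a\<in>F. le_mod K lam J a u)"
    and dir: "directed_card ?P (le_mod K lam J) |F|"
    by blast
  have "\<And>a. a \<in> Field |F| \<Longrightarrow> a \<in> ?P" using F(1) by (auto simp: Field_card_of)
  from increasing_majorants[where p = "\<lambda>a. a", OF J card_of_Card_order dir this]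
  obtain f where f: "\<And>a. a \<in> F \<Longrightarrow> f a \<in> ?P \<and> (\<forall>i\<in>K. (a i, f a i) \<in> lam i)"
    and inc: "\<And>a b. (a, b) \<in> |F| - Id \<Longrightarrow> less_mod K lam J (f a) (f b)"
    by (auto simp: Field_card_of)
  have mono: "le_mod K lam J (f a) (f b)" if ab: "(a, b) \<in> |F|" for a b
  proof (cases "a = b")
    case True
    have "a \<in> F" using ab by (metis FieldI1 Field_card_of)
    then show ?thesis using True f lam_refl card_prod_mem le_mod_pointwise[OF J] by blast
  next
    case False
    then show ?thesis using ab inc less_mod_imp_le_mod[OF J] by blast
  qed
  have below: "le_mod K lam J a (f a)" if "a \<in> F" for a
    using f[OF that] le_mod_pointwise[OF J] by blast
  have tot: "(a, b) \<in> |F| \<or> (b, a) \<in> |F|" if "a \<in> F" "b \<in> F" for a b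
    using card_of_Well_order[of F] wo_rel.TOTALS[of "|F|"] that Field_card_of[of F]
    unfolding wo_rel_def by blast
  have X: "directed_card F (\<lambda>a b. (a, b) \<in> |F| ) (cardSuc theta)"
    unfolding directed_card_def
  proof (intro allI impI, rule ccontr)
    fix S assume S: "S \<subseteq> F \<and> |S| <o cardSuc theta" and "\<not> (\<exists>b\<in>F. \<forall>a\<in>S. (a, b) \<in> |F| )"
    then have cof: "\<exists>a\<in>S. (b, a) \<in> |F|" if "b \<in> F" for b using tot that by blast
    have "|f ` S| <o cardSuc theta"
      using conjunct2[OF S] by (rule ordLeq_ordLess_trans[OF card_of_image])
    moreover have "f ` S \<subseteq> ?P" using S f by blast
    ultimately obtain u where u: "u \<in> ?P" "\<And>a. a \<in> S \<Longrightarrow> le_mod K lam I (f a) u"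
      using directed_cardD[OF directed, of "f ` S"] by blast
    have "le_mod K lam J b u" if b: "b \<in> F" for b
    proof -
      obtain a where a: "a \<in> S" "(b, a) \<in> |F|" using cof b by blast
      have "le_mod K lam J (f a) u" using u(2)[OF a(1)] le_mod_mono[OF IJ] by blast
      then show ?thesis using below[OF b] mono[OF a(2)] le_mod_trans[OF J] by blast
    qed
    then show False using F(3) u(1) by blast
  qed
  obtain g where g: "g \<in> ?P" and gap: "\<And>g' a. g' \<in> ?P \<Longrightarrow> a \<in> F \<Longrightarrow> \<exists>b\<in>F. (a, b) \<in> |F| \<and>
     {i \<in> K. (g i, f b i) \<in> lam i - Id \<and> (f b i, g' i) \<in> lam i} \<in> I"
    using eventual_gap[OF X] by blast
  have "le_mod K lam J (f a) g" if a: "a \<in> F" for a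
  proof (rule ccontr)
    assume "\<not> ?thesis"
    then have "{i \<in> K. (f a i, g i) \<notin> lam i} \<notin> J" unfolding le_mod_def by blast
    then obtain D and mu :: "('k \<Rightarrow> 'a) rel" where D: "ultrafilter_on K D" "D \<inter> I = {}"
      and B: "{i \<in> K. (f a i, g i) \<notin> lam i} \<in> D"
      and mu: "prod_is_tcf K lam (dual_ideal K D) mu" "l \<le>o mu"
      unfolding J_def J_less_def by blast
    have "J \<subseteq> dual_ideal K D"
      unfolding J_def using subset_dual_ideal[OF D(1) J_less_subset_Pow J_less_disjoint[OF D mu]] .
    note JD = le_mod_mono[OF this]
    have "|f ` F| <o mu"
      using ordLess_ordLeq_trans[OF ordLeq_ordLess_trans[OF card_of_image F(2)] mu(2)] .
    moreover have "f ` F \<subseteq> ?P" using f by blast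
    ultimately obtain h where h: "h \<in> ?P" "\<And>b. b \<in> F \<Longrightarrow> le_mod K lam (dual_ideal K D) (f b) h"
      using directed_cardD[OF directed_below_tcf[OF D(1) mu(1)], of "f ` F"] by blast
    obtain b where b: "b \<in> F" "(a, b) \<in> |F|"
      and small: "{i \<in> K. (g i, f b i) \<in> lam i - Id \<and> (f b i, h i) \<in> lam i} \<in> I"
      using gap[OF h(1) a] by blast
    have "{i \<in> K. (f a i, f b i) \<in> lam i} \<in> D"
      using JD[OF mono[OF b(2)]] le_mod_dual_ideal[OF D(1)] by blast
    moreover have "{i \<in> K. (f b i, h i) \<in> lam i} \<in> D"
      using h(2)[OF b(1)] le_mod_dual_ideal[OF D(1)] by blast
    ultimately have "{i \<in> K. (f a i, g i) \<notin> lam i} \<inter>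
        ({i \<in> K. (f a i, f b i) \<in> lam i} \<inter> {i \<in> K. (f b i, h i) \<in> lam i}) \<in> D"
      using B ultrafilter_on_Int[OF D(1)] by blast
    moreover have "{i \<in> K. (f a i, g i) \<notin> lam i} \<inter>
        ({i \<in> K. (f a i, f b i) \<in> lam i} \<inter> {i \<in> K. (f b i, h i) \<in> lam i})
        \<subseteq> {i \<in> K. (g i, f b i) \<in> lam i - Id \<and> (f b i, h i) \<in> lam i}"
    proof -
      have "(g i, f b i) \<in> lam i - Id" if i: "i \<in> K" "(f a i, g i) \<notin> lam i" "(f a i, f b i) \<in> lam i" for i
      proof -
        have "(g i, f a i) \<in> lam i - Id" using i(1,2) f[OF a] g lam_total card_prod_mem by blast
        then show ?thesis using i lam_less_le_trans by blast
      qed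
      then show ?thesis by blast
    qed
    ultimately have "{i \<in> K. (g i, f b i) \<in> lam i - Id \<and> (f b i, h i) \<in> lam i} \<in> D"
      by (rule ultrafilter_on_mono[OF D(1)]) blast
    then show False using small D(2) by blast
  qed
  then have "\<forall>a\<in>F. le_mod K lam J a g" using below le_mod_trans[OF J] by blast
  then show False using F(3) g by blast
qed

section \<open>Generators\<close>

text \<open>
  A sequence cofinal modulo \<open>D\<close> can be replaced by increasing majorants modulo the pcf ideal.
  Its index set is \<open>theta\<^sup>+\<close>-directed because a bound modulo \<open>I\<close> of \<open>theta\<close> members of the original
  sequence lies below some member modulo \<open>D\<close>. For the function \<open>g\<close> of the gap lemma and an index
  \<open>a0\<close> with \<open>g < f a0\<close> modulo \<open>D\<close>, the set where \<open>g < f a0\<close> is the generator: on it the sequence is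
  above \<open>g\<close> from \<open>a0\<close> on, so avoiding the gap from \<open>g\<close> to \<open>h\<close> means exceeding \<open>h\<close>.
\<close>

lemma exists_generator:
  fixes l :: "'l rel"
  assumes D: "ultrafilter_on K D" "D \<inter> I = {}"
    and tcf: "prod_is_tcf K lam (dual_ideal K D) l"
  shows "\<exists>B\<in>D. prod_has_tcf B lam (J_less K I lam l) l \<and>
      B \<in> J_le K I lam l - J_less K I lam l"
proof -
  let ?P = "card_prod K lam"
  define J where "J = J_less K I lam l"
  have J: "ideal_on K J" and IJ: "I \<subseteq> J" and JK: "J \<subseteq> Pow K"
    unfolding J_def using ideal_on_J_less ideal_subset_J_less[OF ideal] J_less_subset_Pow by blast+
  have DJ: "D \<inter> J = {}"
    unfolding J_def using tcf_copy[OF D(1) tcf] J_less_disjoint[OF D] by blast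
  note dual = ideal_on_dual_ideal[OF D(1)]
  have JD: "J \<subseteq> dual_ideal K D" using subset_dual_ideal[OF D(1) JK DJ] .
  have ID: "I \<subseteq> dual_ideal K D" using IJ JD by blast
  obtain p where l: "Card_order l" and p: "\<And>a. a \<in> Field l \<Longrightarrow> p a \<in> ?P"
    and pinc: "\<And>a b. (a, b) \<in> l - Id \<Longrightarrow> less_mod K lam (dual_ideal K D) (p a) (p b)"
    and pcof: "\<And>q. q \<in> ?P \<Longrightarrow> \<exists>a\<in>Field l. le_mod K lam (dual_ideal K D) q (p a)"
    using is_tcf_has_tcf[OF tcf] unfolding has_tcf_def by blast
  have "directed_card ?P (le_mod K lam J) l" unfolding J_def by (rule directed_mod_J_less)
  from increasing_majorants[where p = p, OF J l this p]
  obtain f where f: "\<And>a. a \<in> Field l \<Longrightarrow> f a \<in> ?P \<and> (\<forall>i\<in>K. (p a i, f a i) \<in> lam i)"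
    and inc: "\<And>a b. (a, b) \<in> l - Id \<Longrightarrow> less_mod K lam J (f a) (f b)" by blast
  have X: "directed_card (Field l) (\<lambda>a b. (a, b) \<in> l) (cardSuc theta)"
    unfolding directed_card_def
  proof (intro allI impI)
    fix S assume S: "S \<subseteq> Field l \<and> |S| <o cardSuc theta"
    have "|p ` S| <o cardSuc theta"
      using conjunct2[OF S] by (rule ordLeq_ordLess_trans[OF card_of_image])
    moreover have "p ` S \<subseteq> ?P" using S p by blast
    ultimately obtain u where u: "u \<in> ?P" "\<And>a. a \<in> S \<Longrightarrow> le_mod K lam I (p a) u"
      using directed_cardD[OF directed, of "p ` S"] by blast
    obtain b where b: "b \<in> Field l" "le_mod K lam (dual_ideal K D) u (p b)"
      using pcof[OF u(1)] by blast
    have "(a, b) \<in> l" if a: "a \<in> S" for a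
    proof (rule ccontr)
      assume "(a, b) \<notin> l"
      then have "(b, a) \<in> l - Id"
        using l wo_rel.TOTALS[of l] wo_rel.REFL[of l] S a b(1)
        unfolding card_order_on_def wo_rel_def refl_on_def by blast
      moreover have "le_mod K lam (dual_ideal K D) (p a) (p b)"
        using le_mod_trans[OF dual le_mod_mono[OF ID u(2)[OF a]] b(2)] .
      ultimately show False using pinc less_le_mod_dual_contradiction[OF D(1)] by blast
    qed
    then show "\<exists>b\<in>Field l. \<forall>a\<in>S. (a, b) \<in> l" using b(1) by blast
  qed
  obtain g where g: "g \<in> ?P"
    and gap: "\<And>h a. h \<in> ?P \<Longrightarrow> a \<in> Field l \<Longrightarrow> \<exists>b\<in>Field l. (a, b) \<in> l \<and>
     {i \<in> K. (g i, f b i) \<in> lam i - Id \<and> (f b i, h i) \<in> lam i} \<in> I"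
    using eventual_gap[OF X] by blast
  \<comment> \<open>Cofinality provides only weak bounds, so it is applied to a function strictly above \<open>g\<close>.\<close>
  obtain g1 where g1: "g1 \<in> ?P" "\<And>i. i \<in> K \<Longrightarrow> (g i, g1 i) \<in> lam i - Id"
    using card_prod_greater[OF g g] by blast
  obtain a0 where a0: "a0 \<in> Field l" "le_mod K lam (dual_ideal K D) g1 (p a0)"
    using pcof[OF g1(1)] by blast
  define B where "B = {i \<in> K. (g i, f a0 i) \<in> lam i - Id}"
  have BK: "B \<subseteq> K" unfolding B_def by blast
  have BD: "B \<in> D"
  proof (rule ultrafilter_on_mono[OF D(1) _ _ BK])
    show "{i \<in> K. (g1 i, p a0 i) \<in> lam i} \<in> D" using a0(2) le_mod_dual_ideal[OF D(1)] by blast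
    show "{i \<in> K. (g1 i, p a0 i) \<in> lam i} \<subseteq> B"
      unfolding B_def using g1(2) f[OF a0(1)] lam_less_le_trans by blast
  qed
  have cof: "\<exists>b\<in>Field l. {i \<in> B. (h i, f b i) \<notin> lam i - Id} \<in> J" if h: "h \<in> ?P" for h
  proof -
    obtain b where b: "b \<in> Field l" "(a0, b) \<in> l"
      and small: "{i \<in> K. (g i, f b i) \<in> lam i - Id \<and> (f b i, h i) \<in> lam i} \<in> I"
      using gap[OF h a0(1)] by blast
    have "le_mod K lam J (f a0) (f b)"
    proof (cases "a0 = b")
      case True
      then show ?thesis using f[OF b(1)] lam_refl card_prod_mem le_mod_pointwise[OF J] by blast
    next
      case False
      then show ?thesis using b(2) inc less_mod_imp_le_mod[OF J] by blast
    qed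
    then have "{i \<in> K. (f a0 i, f b i) \<notin> lam i} \<in> J" unfolding le_mod_def by blast
    moreover have "{i \<in> K. (g i, f b i) \<in> lam i - Id \<and> (f b i, h i) \<in> lam i} \<in> J"
      using small IJ by blast
    moreover have "{i \<in> B. (h i, f b i) \<notin> lam i - Id} \<subseteq> {i \<in> K. (f a0 i, f b i) \<notin> lam i} \<union>
        {i \<in> K. (g i, f b i) \<in> lam i - Id \<and> (f b i, h i) \<in> lam i}"
    proof
      fix i assume i: "i \<in> {i \<in> B. (h i, f b i) \<notin> lam i - Id}"
      then have iK: "i \<in> K" and gf: "(g i, f a0 i) \<in> lam i - Id" unfolding B_def by blast+
      have "(f b i, h i) \<in> lam i"
        using i lam_total[OF iK, of "f b i" "h i"] f[OF b(1)] h card_prod_mem[OF _ iK] by blast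
      then show "i \<in> {i \<in> K. (f a0 i, f b i) \<notin> lam i} \<union>
        {i \<in> K. (g i, f b i) \<in> lam i - Id \<and> (f b i, h i) \<in> lam i}"
        using iK lam_less_le_trans[OF iK gf] by blast
    qed
    ultimately show ?thesis using b(1) ideal_on_Un_subset[OF J] by blast
  qed
  have "prod_has_tcf B lam J l"
    unfolding has_tcf_def
  proof (intro conjI exI[of _ "\<lambda>a. restrict (f a) B"] ballI allI impI)
    show "Card_order l" by (rule l)
    show "restrict (f a) B \<in> card_prod B lam" if "a \<in> Field l" for a
      using f[OF that] card_prod_mem BK unfolding card_prod_def by auto
    show "less_mod B lam J (restrict (f a) B) (restrict (f b) B)" if ab: "(a, b) \<in> l - Id" for a b
    proof -
      have "{i \<in> B. (restrict (f a) B i, restrict (f b) B i) \<notin> lam i - Id}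
          \<subseteq> {i \<in> K. (f a i, f b i) \<notin> lam i - Id}" using BK by auto
      moreover have "{i \<in> K. (f a i, f b i) \<notin> lam i - Id} \<in> J"
        using inc[OF ab] unfolding less_mod_def by blast
      ultimately have "{i \<in> B. (restrict (f a) B i, restrict (f b) B i) \<notin> lam i - Id} \<in> J"
        using ideal_on_subset[OF J] by blast
      then show ?thesis unfolding less_mod_def by blast
    qed
    show "\<exists>a\<in>Field l. le_mod B lam J q (restrict (f a) B)" if q: "q \<in> card_prod B lam" for q
    proof -
      have "\<exists>h\<in>?P. \<forall>i\<in>K. i \<in> B \<longrightarrow> h i = q i"
      proof (rule card_prod_choice)
        fix i assume i: "i \<in> K"
        show "\<exists>z\<in>Field (lam i). i \<in> B \<longrightarrow> z = q i"
          using q card_prod_mem[OF g i] unfolding card_prod_def by (cases "i \<in> B") auto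
      qed
      then obtain h where h: "h \<in> ?P" "\<And>i. i \<in> B \<Longrightarrow> h i = q i" using BK by blast
      obtain b where b: "b \<in> Field l" "{i \<in> B. (h i, f b i) \<notin> lam i - Id} \<in> J"
        using cof[OF h(1)] by blast
      have "{i \<in> B. (q i, restrict (f b) B i) \<notin> lam i} \<subseteq> {i \<in> B. (h i, f b i) \<notin> lam i - Id}"
        using h(2) by auto
      then have "{i \<in> B. (q i, restrict (f b) B i) \<notin> lam i} \<in> J"
        using b(2) ideal_on_subset[OF J] by blast
      then show ?thesis using b(1) unfolding le_mod_def by blast
    qed
  qed
  moreover have "B \<notin> J" using BD DJ by blast
  moreover have "B \<in> J_le K I lam l"
  proof (rule ccontr)
    assume "B \<notin> J_le K I lam l"
    then obtain E and mu :: "('k \<Rightarrow> 'a) rel" where E: "ultrafilter_on K E" "E \<inter> I = {}" "B \<in> E"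
      and mu: "prod_is_tcf K lam (dual_ideal K E) mu" "cardSuc l \<le>o mu"
      unfolding J_le_def J_less_def using BK by blast
    have lmu: "l <o mu" using cardSuc_greater[OF l] mu(2) by (rule ordLess_ordLeq_trans)
    have EJ: "E \<inter> J = {}"
      unfolding J_def using J_less_disjoint[OF E(1,2) mu(1) ordLess_imp_ordLeq[OF lmu]] .
    \<comment> \<open>The sequence has length below the true cofinality modulo \<open>E\<close>, yet is cofinal on \<open>B \<in> E\<close>.\<close>
    have "|f ` Field l| \<le>o l"
      using card_of_image card_of_Field_ordIso[OF l] by (rule ordLeq_ordIso_trans)
    then have "|f ` Field l| <o mu" using lmu by (rule ordLeq_ordLess_trans)
    moreover have "f ` Field l \<subseteq> ?P" using f by blast
    ultimately obtain u where u: "u \<in> ?P"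
      "\<And>a. a \<in> Field l \<Longrightarrow> le_mod K lam (dual_ideal K E) (f a) u"
      using directed_cardD[OF directed_below_tcf[OF E(1) mu(1)], of "f ` Field l"] by blast
    obtain b where b: "b \<in> Field l" "{i \<in> B. (u i, f b i) \<notin> lam i - Id} \<in> J"
      using cof[OF u(1)] by blast
    have "{i \<in> B. (u i, f b i) \<notin> lam i - Id} \<notin> E" using b(2) EJ by blast
    moreover have "{i \<in> B. (u i, f b i) \<notin> lam i - Id} \<subseteq> K" using BK by blast
    ultimately have "K - {i \<in> B. (u i, f b i) \<notin> lam i - Id} \<in> E"
      using ultrafilter_on_compl[OF E(1)] by simp
    then have "B \<inter> (K - {i \<in> B. (u i, f b i) \<notin> lam i - Id}) \<in> E"
      using E(3) ultrafilter_on_Int[OF E(1)] by blast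
    moreover have "B \<inter> (K - {i \<in> B. (u i, f b i) \<notin> lam i - Id}) \<subseteq> {i \<in> K. (u i, f b i) \<in> lam i - Id}"
      using BK by blast
    ultimately have "{i \<in> K. (u i, f b i) \<in> lam i - Id} \<in> E"
      by (rule ultrafilter_on_mono[OF E(1)]) blast
    then have "less_mod K lam (dual_ideal K E) u (f b)" using less_mod_dual_ideal[OF E(1)] by blast
    then show False using u(2)[OF b(1)] less_le_mod_dual_contradiction[OF E(1)] by blast
  qed
  ultimately show ?thesis using BD unfolding J_def by blast
qed

end

text \<open>
  If every factor exceeds \<open>theta\<close>, then so does the liminf, which is at least as large as some
  factor, and \<open>theta\<close> many functions are bounded pointwise, because the factors are regular. So the
  first alternative of the theorem is a case of the second.
\<close>

lemma (in regular_product) large_factors: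
  fixes theta :: "'t rel"
  assumes I: "proper_ideal_on K I" and theta: "Card_order theta"
    and large: "\<And>i. i \<in> K \<Longrightarrow> theta <o lam i"
  shows "theta \<le>o liminf_card K I lam"
    and "directed_card (card_prod K lam) (le_mod K lam I) (cardSuc theta)"
proof -
  let ?L = "liminf_card K I lam"
  have ideal: "ideal_on K I" using I unfolding proper_ideal_on_def by blast
  have "is_least_card (\<lambda>mu. {i \<in> K. lam i \<le>o mu} \<in> positive_sets K I) ?L"
    using I lam_Card_order by (rule is_least_card_liminf_card)
  then have "{i \<in> K. lam i \<le>o ?L} \<notin> I" unfolding is_least_card_def positive_sets_def by simp
  moreover have "{} \<in> I" using ideal unfolding ideal_on_def by simp
  ultimately have "{i \<in> K. lam i \<le>o ?L} \<noteq> {}" by metis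
  then obtain i where i: "i \<in> K" "lam i \<le>o ?L" by blast
  show "theta \<le>o ?L" using ordLess_imp_ordLeq[OF ordLess_ordLeq_trans[OF large[OF i(1)] i(2)]] .
  show "directed_card (card_prod K lam) (le_mod K lam I) (cardSuc theta)"
    unfolding directed_card_def
  proof (intro allI impI)
    fix A assume A: "A \<subseteq> card_prod K lam \<and> |A| <o cardSuc theta"
    then have At: "|A| \<le>o theta"
      by (simp add: cardSuc_ordLeq_ordLess[OF theta card_of_Card_order])
    have "\<exists>u\<in>card_prod K lam. \<forall>i\<in>K. \<forall>a\<in>A. (a i, u i) \<in> lam i"
    proof (rule card_prod_choice)
      fix i assume i: "i \<in> K"
      let ?A = "(\<lambda>a. a i) ` A"
      have "|?A| <o lam i"
        using ordLeq_ordLess_trans[OF card_of_image ordLeq_ordLess_trans[OF At large[OF i]]] .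
      moreover have "?A \<subseteq> Field (lam i)" using A card_prod_mem[OF _ i] by blast
      ultimately show "\<exists>z\<in>Field (lam i). \<forall>a\<in>A. (a i, z) \<in> lam i"
        using lam_bounded[OF i, of ?A] by blast
    qed
    then show "\<exists>u\<in>card_prod K lam. \<forall>a\<in>A. le_mod K lam I a u"
      using le_mod_pointwise[OF ideal] by blast
  qed
qed

theorem lemma1p6:
  fixes kappa :: "'k rel" and lam :: "'k \<Rightarrow> 'a rel" and I :: "'k set set"
    and theta :: "'t rel" and D :: "'k set set" and l :: "'l rel"
  defines "K \<equiv> Field kappa"
  assumes kappa: "Cinfinite kappa"
    and I: "proper_ideal_on K I"
    and lam: "\<And>i. i \<in> K \<Longrightarrow> Cinfinite (lam i) \<and> regularCard (lam i)"
    and theta: "Card_order theta"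
    and hyp: "((\<forall>i\<in>K. theta <o lam i) \<and> wsat K I \<le>o theta) \<or>
      (theta \<le>o liminf_card K I lam \<and> wsat K I \<le>o theta \<and>
       directed_card (card_prod K lam) (le_mod K lam I) (cardSuc theta))"
    and D: "ultrafilter_on K D" "D \<inter> I = {}"
    and tcf: "prod_is_tcf K lam (dual_ideal K D) l"
  shows "\<exists>B\<in>D. prod_has_tcf B lam (J_less K I lam l) l \<and>
      B \<in> J_le K I lam l - J_less K I lam l"
proof -
  interpret regular_product K lam using lam by unfold_locales
  have "wsat K I \<le>o theta" "theta \<le>o liminf_card K I lam"
    "directed_card (card_prod K lam) (le_mod K lam I) (cardSuc theta)"
    using hyp large_factors[OF I theta] by blast+
  then interpret pcf_product K lam I theta using I theta by unfold_locales
  show ?thesis using exists_generator[OF D tcf] .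
qed

end
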